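(* Let $\mathcal{A}$ be a downset in $\mathcal{B}(n)$, and let $\mathcal{I}$ be the set of the first $|\mathcal{A}|$ elements of the level-colex order on $\mathcal{B}(n)$. Then $m(\mathcal{A}) \le m(\mathcal{I})$.
   Context: $\mathcal{B}(n)$ is the Boolean lattice of all subsets of $[n]=\{1,\dots,n\}$ ordered by inclusion. A downset is a family $\mathcal{D}$ such that $X \in \mathcal{D}$ and $Y \subseteq X$ imply $Y \in \mathcal{D}$. For a downset $\mathcal{D}$, $m(\mathcal{D})$ denotes the number of inclusion-maximal elements of $\mathcal{D}$. The level-colex order on $\mathcal{B}(n)$ is the total order with $A<B$ if either $|A|<|B|$, or $|A|=|B|$ and $\max(A \triangle B) \in B$. *)

theory Defs
  imports Main
begin

definition boolean_lattice :: "nat \<Rightarrow> nat set set" where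
  "boolean_lattice n = Pow {1..n}"

definition downset :: "nat \<Rightarrow> nat set set \<Rightarrow> bool" where
  "downset n D \<longleftrightarrow> D \<subseteq> boolean_lattice n \<and> (\<forall>X Y. X \<in> D \<longrightarrow> Y \<subseteq> X \<longrightarrow> Y \<in> D)"

definition maximal_elements :: "nat set set \<Rightarrow> nat set set" where
  "maximal_elements D = {X \<in> D. \<forall>Y\<in>D. X \<subseteq> Y \<longrightarrow> Y = X}"

definition num_maximal :: "nat set set \<Rightarrow> nat" where
  "num_maximal D = card (maximal_elements D)"

text \<open>The conjunct \<open>A \<noteq> B\<close> guards against \<open>Max {}\<close>, which is unspecified.\<close>

definition level_colex_less :: "nat set \<Rightarrow> nat set \<Rightarrow> bool" where
  "level_colex_less A B \<longleftrightarrow>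
     card A < card B \<or> (card A = card B \<and> A \<noteq> B \<and> Max (sym_diff A B) \<in> B)"

text \<open>The first \<open>k\<close> elements are those with fewer than \<open>k\<close> predecessors. The lemmas
  \<open>card_level_colex_first\<close> and \<open>level_colex_first_less\<close> below confirm that for \<open>k \<le> 2 ^ n\<close>
  these are exactly \<open>k\<close> sets, each preceding every remaining set.\<close>

definition level_colex_first :: "nat \<Rightarrow> nat \<Rightarrow> nat set set" where
  "level_colex_first n k =
     {X \<in> boolean_lattice n. card {Y \<in> boolean_lattice n. level_colex_less Y X} < k}"

lemma finite_boolean_lattice: "finite (boolean_lattice n)"
  by (simp add: boolean_lattice_def)

lemma card_boolean_lattice: "card (boolean_lattice n) = 2 ^ n"
  by (simp add: boolean_lattice_def card_Pow)

lemma finite_in_boolean_lattice: "X \<in> boolean_lattice n \<Longrightarrow> finite X"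
  by (auto simp: boolean_lattice_def intro: finite_subset)

lemma Max_sym_diff_in_iff:
  fixes A B :: "nat set"
  assumes "finite A" "finite B"
  shows "(A \<noteq> B \<and> Max (sym_diff A B) \<in> B) \<longleftrightarrow>
         (\<exists>i. i \<in> B \<and> i \<notin> A \<and> (\<forall>j>i. j \<in> A \<longleftrightarrow> j \<in> B))"
proof
  assume L: "A \<noteq> B \<and> Max (sym_diff A B) \<in> B"
  let ?i = "Max (sym_diff A B)"
  have fin: "finite (sym_diff A B)" and "sym_diff A B \<noteq> {}"
    using assms L by auto
  then have "?i \<in> sym_diff A B" by (rule Max_in)
  then have "?i \<notin> A" using L by blast
  moreover have "j \<in> A \<longleftrightarrow> j \<in> B" if "j > ?i" for j
    using Max_ge[OF fin, of j] that by auto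
  ultimately show "\<exists>i. i \<in> B \<and> i \<notin> A \<and> (\<forall>j>i. j \<in> A \<longleftrightarrow> j \<in> B)"
    using L by blast
next
  assume "\<exists>i. i \<in> B \<and> i \<notin> A \<and> (\<forall>j>i. j \<in> A \<longleftrightarrow> j \<in> B)"
  then obtain i where i: "i \<in> B" "i \<notin> A" "\<And>j. j > i \<Longrightarrow> j \<in> A \<longleftrightarrow> j \<in> B"
    by blast
  have "Max (sym_diff A B) = i"
  proof (rule Max_eqI)
    show "finite (sym_diff A B)" using assms by simp
    show "y \<le> i" if "y \<in> sym_diff A B" for y
      using i(3)[of y] that by (meson DiffE UnE not_le)
    show "i \<in> sym_diff A B" using i by simp
  qed
  then show "A \<noteq> B \<and> Max (sym_diff A B) \<in> B" using i by auto
qed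

lemma level_colex_less_irrefl: "\<not> level_colex_less A A"
  by (simp add: level_colex_less_def)

lemma level_colex_less_total:
  assumes "finite A" "finite B" "A \<noteq> B"
  shows "level_colex_less A B \<or> level_colex_less B A"
proof -
  have "Max (sym_diff A B) \<in> sym_diff A B"
    using assms by (intro Max_in) auto
  then have "Max (sym_diff A B) \<in> A \<or> Max (sym_diff A B) \<in> B" by blast
  moreover have "sym_diff B A = sym_diff A B" by (rule Un_commute)
  ultimately show ?thesis
    using assms(3) by (cases "card A" "card B" rule: linorder_cases) (auto simp only: level_colex_less_def)
qed

lemma level_colex_less_trans:
  assumes fin: "finite A" "finite B" "finite C"
    and AB: "level_colex_less A B" and BC: "level_colex_less B C"
  shows "level_colex_less A C"
proof (cases "card A = card B \<and> card B = card C")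
  case False
  then show ?thesis using AB BC by (auto simp: level_colex_less_def)
next
  case True
  obtain i where i: "i \<in> B" "i \<notin> A" "\<forall>j>i. j \<in> A \<longleftrightarrow> j \<in> B"
    using AB True Max_sym_diff_in_iff[OF fin(1,2)] by (auto simp: level_colex_less_def)
  obtain k where k: "k \<in> C" "k \<notin> B" "\<forall>j>k. j \<in> B \<longleftrightarrow> j \<in> C"
    using BC True Max_sym_diff_in_iff[OF fin(2,3)] by (auto simp: level_colex_less_def)
  have "max i k \<in> C \<and> max i k \<notin> A \<and> (\<forall>j>max i k. j \<in> A \<longleftrightarrow> j \<in> C)"
    using i k by (cases i k rule: linorder_cases) (auto simp: max_def)
  then show ?thesis
    using True Max_sym_diff_in_iff[OF fin(1,3)] by (auto simp: level_colex_less_def)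
qed

lemma level_colex_rank_mono:
  assumes X: "X \<in> boolean_lattice n" and Y: "Y \<in> boolean_lattice n" and "level_colex_less X Y"
  shows "card {Z \<in> boolean_lattice n. level_colex_less Z X}
       < card {Z \<in> boolean_lattice n. level_colex_less Z Y}"
proof (rule psubset_card_mono)
  show "finite {Z \<in> boolean_lattice n. level_colex_less Z Y}"
    by (simp add: finite_boolean_lattice)
  show "{Z \<in> boolean_lattice n. level_colex_less Z X}
      \<subset> {Z \<in> boolean_lattice n. level_colex_less Z Y}"
  proof
    show "{Z \<in> boolean_lattice n. level_colex_less Z X}
        \<subseteq> {Z \<in> boolean_lattice n. level_colex_less Z Y}"
      using level_colex_less_trans[OF _ _ _ _ assms(3)] X Y finite_in_boolean_lattice by auto
    show "{Z \<in> boolean_lattice n. level_colex_less Z X}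
        \<noteq> {Z \<in> boolean_lattice n. level_colex_less Z Y}"
      using X assms(3) level_colex_less_irrefl[of X] by auto
  qed
qed

lemma level_colex_first_less:
  assumes X: "X \<in> level_colex_first n k" and Y: "Y \<in> boolean_lattice n - level_colex_first n k"
  shows "level_colex_less X Y"
proof (rule ccontr)
  assume "\<not> level_colex_less X Y"
  moreover have XY: "X \<in> boolean_lattice n" "Y \<in> boolean_lattice n" "X \<noteq> Y"
    using X Y by (auto simp: level_colex_first_def)
  ultimately have "level_colex_less Y X"
    using level_colex_less_total[of X Y] finite_in_boolean_lattice[of _ n] by simp
  then show False
    using level_colex_rank_mono[of Y n X] X Y XY by (auto simp: level_colex_first_def)
qed

lemma card_level_colex_first:
  assumes "k \<le> 2 ^ n"
  shows "card (level_colex_first n k) = k"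
proof -
  let ?B = "boolean_lattice n"
  define r where "r X = card {Y \<in> ?B. level_colex_less Y X}" for X
  have inj: "inj_on r ?B"
  proof (rule inj_onI, rule ccontr)
    fix X Y assume XY: "X \<in> ?B" "Y \<in> ?B" "r X = r Y" "X \<noteq> Y"
    then have "level_colex_less X Y \<or> level_colex_less Y X"
      using level_colex_less_total[of X Y] finite_in_boolean_lattice[of _ n] by simp
    then show False
      using level_colex_rank_mono[of X n Y] level_colex_rank_mono[of Y n X] XY
      by (auto simp: r_def)
  qed
  have "r X < card ?B" if "X \<in> ?B" for X
    unfolding r_def
  proof (rule psubset_card_mono[OF finite_boolean_lattice])
    show "{Y \<in> ?B. level_colex_less Y X} \<subset> ?B"
      using that level_colex_less_irrefl[of X] by blast
  qed
  then have "r ` ?B \<subseteq> {..<2 ^ n}"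
    by (auto simp: card_boolean_lattice)
  moreover have "card (r ` ?B) = 2 ^ n"
    by (simp add: card_image[OF inj] card_boolean_lattice)
  ultimately have img: "r ` ?B = {..<2 ^ n}"
    by (intro card_subset_eq) auto
  have first: "level_colex_first n k = {X \<in> ?B. r X < k}"
    by (simp add: level_colex_first_def r_def)
  have "r ` level_colex_first n k = {..<k}"
  proof
    show "{..<k} \<subseteq> r ` level_colex_first n k"
    proof
      fix i assume "i \<in> {..<k}"
      then have "i < k" "i \<in> r ` ?B" using assms img by auto
      then show "i \<in> r ` level_colex_first n k" by (auto simp: first)
    qed
  qed (auto simp: first)
  moreover have "inj_on r (level_colex_first n k)"
    by (rule inj_on_subset[OF inj]) (auto simp: first)
  ultimately show ?thesis
    by (metis card_image card_lessThan)
qed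

end

theory Submission
  imports Defs
begin

text \<open>For a downset \<open>F\<close> the non-maximal elements are exactly the elements of its shadow, so the
  claim is that initial segments of level-colex minimise the shadow among downsets of a given
  size. Split \<open>F\<close> at a point \<open>i\<close> into the sets avoiding \<open>i\<close> and the links of \<open>i\<close>, two nested
  downsets on one point less, and replace both by initial segments. By induction, and because
  shadows of initial segments are again initial segments, hence nested, this does not enlarge
  the shadow. A downset which is stable under these compressions for all \<open>i\<close> and is not itself
  an initial segment differs from one only by exchanging some \<open>Y\<close> for its immediate successor
  \<open>X\<close>, where \<open>X\<close> is the complement of \<open>Y\<close>; this case is checked directly.\<close>

section \<open>Notions relative to an arbitrary ground set\<close>

definition down_closed :: "'a set set \<Rightarrow> bool" where
  "down_closed F \<longleftrightarrow> (\<forall>X Y. X \<in> F \<longrightarrow> Y \<subseteq> X \<longrightarrow> Y \<in> F)"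

text \<open>The lower shadow, taken on all levels at once: every set that arises from a member by
  deleting exactly one element.\<close>

definition shadow :: "'a set set \<Rightarrow> 'a set set" where
  "shadow F = {X. \<exists>j. j \<notin> X \<and> insert j X \<in> F}"

text \<open>The ground set is arbitrary because the induction deletes arbitrary points; the order
  itself mentions no ground set, so nothing has to be relabelled.\<close>

definition level_colex_initial :: "nat set \<Rightarrow> nat set set \<Rightarrow> bool" where
  "level_colex_initial S F \<longleftrightarrow>
     F \<subseteq> Pow S \<and> (\<forall>X\<in>F. \<forall>Y\<in>Pow S. level_colex_less Y X \<longrightarrow> Y \<in> F)"

definition join_at :: "'a \<Rightarrow> 'a set set \<Rightarrow> 'a set set \<Rightarrow> 'a set set" where
  "join_at i F0 F1 = F0 \<union> insert i ` F1"

definition deletion :: "'a \<Rightarrow> 'a set set \<Rightarrow> 'a set set" where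
  "deletion i F = {X \<in> F. i \<notin> X}"

definition link :: "'a \<Rightarrow> 'a set set \<Rightarrow> 'a set set" where
  "link i F = {X. i \<notin> X \<and> insert i X \<in> F}"

text \<open>Position in the order, counted from 0. Its sum over a family is the potential that makes
  repeated compression stop.\<close>

definition level_colex_rank :: "nat set \<Rightarrow> nat set \<Rightarrow> nat" where
  "level_colex_rank S X = card {Z \<in> Pow S. level_colex_less Z X}"


section \<open>The level-colex order\<close>

lemma level_colex_less_if_card: "card A < card B \<Longrightarrow> level_colex_less A B"
  by (simp add: level_colex_less_def)

lemma level_colex_less_iff:
  assumes "finite A" "finite B"
  shows "level_colex_less A B \<longleftrightarrow> card A < card B \<or>
    card A = card B \<and> (\<exists>d. d \<in> B \<and> d \<notin> A \<and> (\<forall>j>d. j \<in> A \<longleftrightarrow> j \<in> B))"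
  unfolding level_colex_less_def using Max_sym_diff_in_iff[OF assms] by simp

text \<open>A common new element leaves the symmetric difference unchanged and raises both sizes by
  one. This lets the order be compared on links.\<close>

lemma level_colex_less_insert_iff:
  assumes "finite A" "finite B" "i \<notin> A" "i \<notin> B"
  shows "level_colex_less (insert i A) (insert i B) \<longleftrightarrow> level_colex_less A B"
proof -
  have "sym_diff (insert i A) (insert i B) = sym_diff A B"
    using assms by auto
  moreover have "insert i A = insert i B \<longleftrightarrow> A = B"
    using assms by (simp add: insert_ident)
  moreover have "Max (sym_diff A B) \<noteq> i" if "A \<noteq> B"
    using Max_in[of "sym_diff A B"] that assms by auto
  ultimately show ?thesis
    using assms by (auto simp: level_colex_less_def)
qed

lemma level_colex_less_exchange:
  assumes "finite U" "s \<notin> U" "j \<notin> U" "s < j"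
  shows "level_colex_less (insert s U) (insert j U)"
  using assms by (subst level_colex_less_iff) (auto intro!: exI[of _ j])

lemma level_colex_rank_less:
  assumes "finite S" "X \<subseteq> S" "Y \<subseteq> S" "level_colex_less X Y"
  shows "level_colex_rank S X < level_colex_rank S Y"
  unfolding level_colex_rank_def
proof (rule psubset_card_mono)
  have fin: "finite Z" if "Z \<subseteq> S" for Z
    using that assms(1) by (rule finite_subset)
  show "{Z \<in> Pow S. level_colex_less Z X} \<subset> {Z \<in> Pow S. level_colex_less Z Y}"
    using level_colex_less_trans[OF fin fin fin _ assms(4)] level_colex_less_irrefl[of X] assms
    by blast
qed (use assms in simp)


section \<open>Initial segments\<close>

text \<open>A proper subset of a finite set is smaller, and size is compared first.\<close>

lemma level_colex_initial_down_closed: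
  assumes "finite S" "level_colex_initial S F"
  shows "down_closed F"
  unfolding down_closed_def
proof (intro allI impI)
  fix X Y assume XY: "X \<in> F" "Y \<subseteq> X"
  then have "X \<subseteq> S" using assms by (auto simp: level_colex_initial_def)
  then have "finite X" using assms(1) by (rule finite_subset)
  then have "Y = X \<or> level_colex_less Y X"
    using XY by (metis level_colex_less_if_card psubsetI psubset_card_mono)
  then show "Y \<in> F"
    using XY assms \<open>X \<subseteq> S\<close> unfolding level_colex_initial_def by blast
qed

text \<open>If each segment had a member outside the other, the earlier of these two members would
  have to lie in both.\<close>

lemma level_colex_initial_nested:
  assumes "finite S" "level_colex_initial S F" "level_colex_initial S G"
  shows "F \<subseteq> G \<or> G \<subseteq> F"
proof (rule ccontr)
  assume "\<not> ?thesis"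
  then obtain X Y where XY: "X \<in> F" "X \<notin> G" "Y \<in> G" "Y \<notin> F" by blast
  then have S: "X \<subseteq> S" "Y \<subseteq> S" using assms by (auto simp: level_colex_initial_def)
  then have "level_colex_less X Y \<or> level_colex_less Y X"
    using level_colex_less_total[of X Y] XY finite_subset[OF _ assms(1)] by blast
  then show False
    using XY S assms unfolding level_colex_initial_def by blast
qed

lemma level_colex_initial_finite:
  "finite S \<Longrightarrow> level_colex_initial S F \<Longrightarrow> finite F"
  unfolding level_colex_initial_def by (meson finite_Pow_iff finite_subset)

lemma level_colex_initial_subset:
  assumes "finite S" "level_colex_initial S F" "level_colex_initial S G" "card F \<le> card G"
  shows "F \<subseteq> G"
  using level_colex_initial_nested[OF assms(1-3)] assms level_colex_initial_finite
  by (metis card_seteq order_refl)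

text \<open>Segments grow one set at a time, each time by a set of least rank among those still
  missing.\<close>

lemma level_colex_initial_exists:
  assumes "finite S" "k \<le> 2 ^ card S"
  shows "\<exists>F. level_colex_initial S F \<and> card F = k"
  using assms(2)
proof (induction k)
  case 0
  show ?case by (rule exI[of _ "{}"]) (simp add: level_colex_initial_def)
next
  case (Suc k)
  then obtain F where F: "level_colex_initial S F" "card F = k" by auto
  have finF: "finite F" using assms(1) F(1) by (rule level_colex_initial_finite)
  have "F \<noteq> Pow S" using F(2) Suc.prems assms(1) by (auto simp: card_Pow)
  then obtain X0 where "X0 \<in> Pow S - F" using F(1) by (auto simp: level_colex_initial_def)
  then obtain X where X: "X \<in> Pow S - F"
    and min: "\<And>Z. Z \<in> Pow S - F \<Longrightarrow> level_colex_rank S X \<le> level_colex_rank S Z"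
    using ex_has_least_nat[of "\<lambda>X. X \<in> Pow S - F" X0 "level_colex_rank S"] by blast
  have "Y \<in> F" if "Y \<subseteq> S" "level_colex_less Y X" for Y
    using min[of Y] level_colex_rank_less[OF assms(1), of Y X] that X by fastforce
  then have "level_colex_initial S (insert X F)"
    using F(1) X by (auto simp: level_colex_initial_def)
  moreover have "card (insert X F) = Suc k" using X F(2) finF by simp
  ultimately show ?case by blast
qed

text \<open>If \<open>X\<close> lies in the shadow through \<open>insert j X\<close> and
  \<open>Y\<close> precedes \<open>X\<close>, then some \<open>b\<close> outside \<open>Y\<close>
  puts \<open>insert b Y\<close> at or before \<open>insert j X\<close>, hence into
  \<open>F\<close>.\<close>

lemma level_colex_initial_shadow:
  assumes "finite S" "level_colex_initial S F"
  shows "level_colex_initial S (shadow F)"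
  unfolding level_colex_initial_def
proof (intro conjI ballI impI)
  have FS: "F \<subseteq> Pow S" and init: "\<And>X Y. X \<in> F \<Longrightarrow> Y \<subseteq> S \<Longrightarrow> level_colex_less Y X \<Longrightarrow> Y \<in> F"
    using assms(2) by (auto simp: level_colex_initial_def)
  show "shadow F \<subseteq> Pow S" using FS by (auto simp: shadow_def)
  fix X Y assume "X \<in> shadow F" and "Y \<in> Pow S" and less: "level_colex_less Y X"
  then obtain j where j: "j \<notin> X" "insert j X \<in> F" and YS: "Y \<subseteq> S"
    by (auto simp: shadow_def)
  have XS: "insert j X \<subseteq> S" using j FS by blast
  have fin: "finite X" "finite Y" using XS YS assms(1) by (auto intro: finite_subset)
  \<comment> \<open>Take \<open>b = j\<close> when \<open>j\<close> is new to \<open>Y\<close>.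
    Otherwise any missing point does if \<open>Y\<close> is smaller than \<open>X\<close>; for equal
    sizes the choice depends on the largest difference \<open>d\<close>.\<close>
  have "\<exists>b. b \<notin> Y \<and> b \<in> S \<and>
      (insert b Y = insert j X \<or> level_colex_less (insert b Y) (insert j X))"
  proof (cases "j \<in> Y")
    case False
    then show ?thesis
      using level_colex_less_insert_iff[OF fin(2,1), of j] j less XS by blast
  next
    case jY: True
    show ?thesis
    proof (cases "card Y < card X")
      case True
      then have "Y \<noteq> S"
        using XS assms(1) card_mono[of S X] by auto
      then obtain b where "b \<in> S" "b \<notin> Y" using YS by blast
      then show ?thesis
        using True fin j by (intro exI[of _ b]) (simp add: level_colex_less_if_card)
    next
      case False
      then have card: "card Y = card X"
        and "\<exists>d. d \<in> X \<and> d \<notin> Y \<and> (\<forall>i>d. i \<in> Y \<longleftrightarrow> i \<in> X)"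
        using less fin by (auto simp: level_colex_less_iff)
      then obtain d where d: "d \<in> X" "d \<notin> Y" "\<And>i. i > d \<Longrightarrow> i \<in> Y \<longleftrightarrow> i \<in> X"
        by blast
      have jd: "j < d" using d j(1) jY by (metis linorder_neqE_nat)
      show ?thesis
      \<comment> \<open>Adding points below \<open>d\<close> on both sides keeps \<open>d\<close>
        the largest difference. If there is no such \<open>b\<close>, then \<open>Y\<close> contains
        all of \<open>S\<close> below \<open>d\<close>, and \<open>b = d\<close> yields
        equality.\<close>
      proof (cases "\<exists>b\<in>S. b \<notin> Y \<and> b < d")
        case True
        then obtain b where b: "b \<in> S" "b \<notin> Y" "b < d" by blast
        have "level_colex_less (insert b Y) (insert j X)"
          using fin b d jd j card by (subst level_colex_less_iff) (auto intro!: exI[of _ d])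
        then show ?thesis using b by blast
      next
        case False
        have "insert j X \<subseteq> insert d Y"
        proof
          fix x assume x: "x \<in> insert j X"
          then have "x \<in> S" using XS by blast
          then show "x \<in> insert d Y"
            using x False d(3)[of x] jY by (cases x d rule: linorder_cases) auto
        qed
        moreover have "card (insert j X) = card (insert d Y)"
          using fin card j d by simp
        ultimately have "insert j X = insert d Y"
          using fin by (intro card_subset_eq) auto
        then show ?thesis using d XS by blast
      qed
    qed
  qed
  then obtain b where b: "b \<notin> Y" "b \<in> S"
    "insert b Y = insert j X \<or> level_colex_less (insert b Y) (insert j X)" by blast
  then have "insert b Y \<in> F" using init[OF j(2), of "insert b Y"] j(2) YS by auto
  then show "Y \<in> shadow F" using b by (auto simp: shadow_def)
qed

text \<open>\<open>F - G\<close> and \<open>G - F\<close> have the same size, and every set of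
  \<open>G - F\<close> precedes every set of \<open>F - G\<close>; any bijection between them
  therefore lowers \<open>g\<close> termwise.\<close>

lemma level_colex_initial_sum_less:
  fixes g :: "nat set \<Rightarrow> nat"
  assumes S: "finite S" and G: "level_colex_initial S G"
    and F: "F \<subseteq> Pow S" "card F = card G" "F \<noteq> G"
    and mono: "\<And>X Y. X \<subseteq> S \<Longrightarrow> Y \<subseteq> S \<Longrightarrow> level_colex_less X Y \<Longrightarrow> g X < g Y"
  shows "sum g G < sum g F"
proof -
  have fin: "finite F" "finite G"
    using S F(1) level_colex_initial_finite[OF S G] by (auto intro: finite_subset)
  have cardeq: "card (F - G) = card (G - F)"
    using F(2) fin by (simp add: card_Diff_subset_Int Int_commute)
  then obtain h where h: "bij_betw h (F - G) (G - F)"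
    using fin by (meson finite_Diff finite_same_card_bij)
  have "F - G \<noteq> {}"
    using F(2,3) fin cardeq by (metis Diff_eq_empty_iff card_subset_eq)
  have less: "g (h X) < g X" if X: "X \<in> F - G" for X
  proof (rule mono)
    have hX: "h X \<in> G - F" using h X by (auto dest: bij_betwE)
    show sub: "h X \<subseteq> S" "X \<subseteq> S" using hX G X F(1) by (auto simp: level_colex_initial_def)
    have "h X \<noteq> X" using hX X by auto
    then have "level_colex_less (h X) X \<or> level_colex_less X (h X)"
      using level_colex_less_total[of "h X" X] sub S by (meson finite_subset)
    then show "level_colex_less (h X) X"
      using hX X sub G unfolding level_colex_initial_def by blast
  qed
  have "sum g (G - F) = (\<Sum>X\<in>F - G. g (h X))"
    using sum.reindex_bij_betw[OF h, of g] by simp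
  also have "\<dots> < sum g (F - G)"
    using fin \<open>F - G \<noteq> {}\<close> less by (intro sum_strict_mono) auto
  finally show ?thesis
    using sum.Int_Diff[OF fin(1), of g G] sum.Int_Diff[OF fin(2), of g F]
    by (simp add: Int_commute)
qed


section \<open>Compression at a point\<close>

lemma join_at_deletion_link: "join_at i (deletion i F) (link i F) = F"
proof -
  have "X \<in> insert i ` link i F" if "X \<in> F" "i \<in> X" for X
    using that by (intro image_eqI[of _ _ "X - {i}"]) (auto simp: link_def insert_absorb)
  then show ?thesis
    by (auto simp: join_at_def deletion_def link_def)
qed

text \<open>Deleting \<open>i\<close> sends the upper half onto \<open>F1\<close>; deleting any
  other point stays within its half.\<close>

lemma shadow_join_at:
  assumes "\<And>X. X \<in> F0 \<Longrightarrow> i \<notin> X" "\<And>X. X \<in> F1 \<Longrightarrow> i \<notin> X"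
  shows "shadow (join_at i F0 F1) = join_at i (F1 \<union> shadow F0) (shadow F1)"
proof (intro equalityI subsetI)
  fix X assume "X \<in> shadow (join_at i F0 F1)"
  then obtain j where j: "j \<notin> X" "insert j X \<in> F0 \<or> insert j X \<in> insert i ` F1"
    by (auto simp: shadow_def join_at_def)
  from j(2) show "X \<in> join_at i (F1 \<union> shadow F0) (shadow F1)"
  proof
    assume "insert j X \<in> F0"
    then show ?thesis using j(1) by (auto simp: shadow_def join_at_def)
  next
    assume "insert j X \<in> insert i ` F1"
    then obtain Z where Z: "Z \<in> F1" "insert j X = insert i Z" by blast
    have iZ: "i \<notin> Z" using assms(2) Z(1) .
    show ?thesis
    proof (cases "j = i")
      case True
      then have "X = Z" using Z j(1) iZ by (simp add: insert_ident)
      then show ?thesis using Z by (simp add: join_at_def)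
    next
      case False
      have "i \<in> insert j X" using Z(2) by simp
      then have "i \<in> X" using False by simp
      moreover have "insert j (X - {i}) = Z"
        using arg_cong[OF Z(2), of "\<lambda>U. U - {i}"] iZ False by (simp add: insert_Diff_if)
      ultimately have "X - {i} \<in> shadow F1" "X = insert i (X - {i})"
        using Z(1) j(1) by (auto simp: shadow_def)
      then show ?thesis by (metis UnI2 imageI join_at_def)
    qed
  qed
next
  fix X assume "X \<in> join_at i (F1 \<union> shadow F0) (shadow F1)"
  then consider "X \<in> F1" | "X \<in> shadow F0"
    | Z j where "X = insert i Z" "j \<notin> Z" "insert j Z \<in> F1"
    by (auto simp: join_at_def shadow_def)
  then show "X \<in> shadow (join_at i F0 F1)"
  proof cases
    case 1
    then show ?thesis using assms(2) by (auto simp: join_at_def shadow_def)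
  next
    case 2
    then show ?thesis by (auto simp: join_at_def shadow_def)
  next
    case 3
    then have "j \<notin> X" "insert j X = insert i (insert j Z)"
      using assms(2)[OF 3(3)] by auto
    then show ?thesis using 3(3) by (auto simp: join_at_def shadow_def)
  qed
qed

text \<open>Stated for general weights, so that it serves both cardinalities and rank sums.\<close>

lemma sum_join_at:
  fixes g :: "'a set \<Rightarrow> 'b::comm_monoid_add"
  assumes "finite F0" "finite F1"
    and "\<And>X. X \<in> F0 \<Longrightarrow> i \<notin> X" "\<And>X. X \<in> F1 \<Longrightarrow> i \<notin> X"
  shows "sum g (join_at i F0 F1) = sum g F0 + (\<Sum>X\<in>F1. g (insert i X))"
proof -
  have "inj_on (insert i) F1"
    using assms(4) by (intro inj_onI) (metis insert_ident)
  moreover have "F0 \<inter> insert i ` F1 = {}" using assms(3) by auto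
  ultimately show ?thesis
    using assms(1,2) by (simp add: join_at_def sum.union_disjoint sum.reindex)
qed

lemma card_join_at:
  assumes "finite F0" "finite F1"
    and "\<And>X. X \<in> F0 \<Longrightarrow> i \<notin> X" "\<And>X. X \<in> F1 \<Longrightarrow> i \<notin> X"
  shows "card (join_at i F0 F1) = card F0 + card F1"
  using sum_join_at[OF assms, of "\<lambda>_. 1 :: nat"] by simp

lemma card_shadow_join_at:
  assumes "finite F0" "finite F1" "finite (shadow F0)" "finite (shadow F1)"
    and "\<And>X. X \<in> F0 \<Longrightarrow> i \<notin> X" "\<And>X. X \<in> F1 \<Longrightarrow> i \<notin> X"
  shows "card (shadow (join_at i F0 F1)) = card (F1 \<union> shadow F0) + card (shadow F1)"
proof -
  have "card (shadow (join_at i F0 F1)) = card (join_at i (F1 \<union> shadow F0) (shadow F1))"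
    using assms by (simp add: shadow_join_at)
  also have "\<dots> = card (F1 \<union> shadow F0) + card (shadow F1)"
    using assms by (intro card_join_at) (auto simp: shadow_def)
  finally show ?thesis .
qed

lemma down_closed_join_at:
  assumes "down_closed F0" "down_closed F1" "F1 \<subseteq> F0"
  shows "down_closed (join_at i F0 F1)"
  unfolding down_closed_def
proof (intro allI impI)
  fix X Y assume X: "X \<in> join_at i F0 F1" and Y: "Y \<subseteq> X"
  then consider "X \<in> F0" | Z where "Z \<in> F1" "X = insert i Z"
    by (auto simp: join_at_def)
  then show "Y \<in> join_at i F0 F1"
  proof cases
    case 1
    then show ?thesis using Y assms(1) by (auto simp: join_at_def down_closed_def)
  next
    case 2
    have "Y - {i} \<in> F1"
      using 2 Y assms(2) unfolding down_closed_def by blast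
    moreover have "Y = Y - {i} \<or> Y = insert i (Y - {i})" by blast
    ultimately show ?thesis using assms(3) by (metis UnI1 UnI2 imageI join_at_def subsetD)
  qed
qed

lemma shadow_subset_Pow: "F \<subseteq> Pow S \<Longrightarrow> shadow F \<subseteq> Pow S"
  by (auto simp: shadow_def)

lemma finite_shadow: "finite S \<Longrightarrow> F \<subseteq> Pow S \<Longrightarrow> finite (shadow F)"
  using shadow_subset_Pow by (metis finite_Pow_iff finite_subset)

text \<open>\<open>F'\<close> joins the initial segments having the sizes of the deletion and the
  link. The theorem for \<open>S - {i}\<close> enters as the hypothesis \<open>IH\<close>, and the
  drop in rank sum is what later excludes uncompressed minimal families.\<close>

lemma compression:
  assumes S: "finite S" "i \<in> S" and F: "F \<subseteq> Pow S" "down_closed F"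
    and IH: "\<And>F G. F \<subseteq> Pow (S - {i}) \<Longrightarrow> down_closed F \<Longrightarrow> level_colex_initial (S - {i}) G \<Longrightarrow>
      card G = card F \<Longrightarrow> card (shadow G) \<le> card (shadow F)"
    and not_initial: "\<not> (level_colex_initial (S - {i}) (deletion i F) \<and>
      level_colex_initial (S - {i}) (link i F))"
  shows "\<exists>F'. F' \<subseteq> Pow S \<and> down_closed F' \<and> card F' = card F \<and>
    card (shadow F') \<le> card (shadow F) \<and>
    sum (level_colex_rank S) F' < sum (level_colex_rank S) F"
proof -
  let ?T = "S - {i}" and ?r = "level_colex_rank S"
  have T: "finite ?T" using S by simp
  define F0 F1 where "F0 = deletion i F" and "F1 = link i F"
  have sub: "F0 \<subseteq> Pow ?T" "F1 \<subseteq> Pow ?T"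
    using F(1) by (auto simp: F0_def F1_def deletion_def link_def)
  have fin: "finite F0" "finite F1"
    using sub T by (metis finite_Pow_iff finite_subset)+
  have finS: "finite (shadow F0)" "finite (shadow F1)"
    using sub T by (auto intro: finite_shadow)
  have dc: "down_closed F0"
    using F(2) unfolding F0_def down_closed_def deletion_def by blast
  have dc1: "down_closed F1"
    unfolding down_closed_def
  proof (intro allI impI)
    fix X Y assume "X \<in> F1" "Y \<subseteq> X"
    then have "insert i X \<in> F" "insert i Y \<subseteq> insert i X" "i \<notin> Y"
      by (auto simp: F1_def link_def)
    then show "Y \<in> F1" using F(2) unfolding F1_def down_closed_def link_def by blast
  qed
  have F10: "F1 \<subseteq> F0"
    using F(2) unfolding F0_def F1_def down_closed_def deletion_def link_def by blast
  have le: "card F0 \<le> 2 ^ card ?T" "card F1 \<le> 2 ^ card ?T"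
    using sub T card_mono[of "Pow ?T"] by (auto simp: card_Pow)
  obtain G0 where G0: "level_colex_initial ?T G0" "card G0 = card F0"
    using level_colex_initial_exists[OF T le(1)] by blast
  obtain G1 where G1: "level_colex_initial ?T G1" "card G1 = card F1"
    using level_colex_initial_exists[OF T le(2)] by blast
  have subG: "G0 \<subseteq> Pow ?T" "G1 \<subseteq> Pow ?T"
    using G0(1) G1(1) by (simp_all add: level_colex_initial_def)
  have finG: "finite G0" "finite G1"
    using subG T by (metis finite_Pow_iff finite_subset)+
  have finSG: "finite (shadow G0)" "finite (shadow G1)"
    using subG T by (auto intro: finite_shadow)
  have notin: "i \<notin> X" if "X \<in> F0 \<or> X \<in> F1 \<or> X \<in> G0 \<or> X \<in> G1" for X
    using that sub subG by blast
  \<comment> \<open>Initial segments are ordered by size, so the inclusion of link in deletion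
    survives; this keeps \<open>F'\<close> down-closed.\<close>
  have G10: "G1 \<subseteq> G0"
    using level_colex_initial_subset[OF T G1(1) G0(1)] G0(2) G1(2) card_mono[OF fin(1) F10]
    by simp
  have Feq: "join_at i F0 F1 = F"
    by (simp add: F0_def F1_def join_at_deletion_link)
  define F' where "F' = join_at i G0 G1"
  have "F' \<subseteq> Pow S"
    using subG S by (auto simp: F'_def join_at_def)
  moreover have "down_closed F'"
    unfolding F'_def using level_colex_initial_down_closed[OF T] G0(1) G1(1) G10
    by (intro down_closed_join_at) auto
  moreover have "card F' = card F"
    unfolding F'_def Feq[symmetric] using fin finG notin G0(2) G1(2) by (simp add: card_join_at)
  moreover have "card (shadow F') \<le> card (shadow F)"
  proof -
    have IH0: "card (shadow G0) \<le> card (shadow F0)" using IH[OF sub(1) dc G0] .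
    have IH1: "card (shadow G1) \<le> card (shadow F1)" using IH[OF sub(2) dc1 G1] .
    \<comment> \<open>Being nested, the two segments have a union no larger than the larger of them,
      whereas \<open>F1 \<union> shadow F0\<close> is at least as large as each of its
      parts.\<close>
    have "G1 \<union> shadow G0 = G1 \<or> G1 \<union> shadow G0 = shadow G0"
      using level_colex_initial_nested[OF T G1(1) level_colex_initial_shadow[OF T G0(1)]] by blast
    moreover have "card F1 \<le> card (F1 \<union> shadow F0)" "card (shadow F0) \<le> card (F1 \<union> shadow F0)"
      using fin finS by (auto intro!: card_mono)
    ultimately have "card (G1 \<union> shadow G0) \<le> card (F1 \<union> shadow F0)"
      using IH0 G1(2) by (elim disjE) simp_all
    then show ?thesis
      unfolding F'_def Feq[symmetric] using fin finG finS finSG notin IH1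
      by (simp add: card_shadow_join_at)
  qed
  moreover have "sum ?r F' < sum ?r F"
  proof -
    \<comment> \<open>Ranks are taken in \<open>S\<close>, not in \<open>S - {i}\<close>, but remain
      strictly monotone along the order on both halves.\<close>
    have mono0: "?r X < ?r Y" if "X \<subseteq> ?T" "Y \<subseteq> ?T" "level_colex_less X Y" for X Y
      using level_colex_rank_less[OF S(1), of X Y] that by blast
    have mono1: "?r (insert i X) < ?r (insert i Y)"
      if "X \<subseteq> ?T" "Y \<subseteq> ?T" "level_colex_less X Y" for X Y
    proof (rule level_colex_rank_less[OF S(1)])
      show "insert i X \<subseteq> S" "insert i Y \<subseteq> S" using that S by auto
      have "finite X" "finite Y" "i \<notin> X" "i \<notin> Y" using that T by (auto intro: finite_subset)
      then show "level_colex_less (insert i X) (insert i Y)"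
        using that(3) by (simp add: level_colex_less_insert_iff)
    qed
    have less0: "sum ?r G0 < sum ?r F0" if "F0 \<noteq> G0"
      using level_colex_initial_sum_less[OF T G0(1) sub(1) _ that, of ?r] G0(2) mono0 by simp
    have less1: "(\<Sum>X\<in>G1. ?r (insert i X)) < (\<Sum>X\<in>F1. ?r (insert i X))" if "F1 \<noteq> G1"
      using level_colex_initial_sum_less[OF T G1(1) sub(2) _ that, of "\<lambda>X. ?r (insert i X)"]
        G1(2) mono1 by simp
    have "F0 \<noteq> G0 \<or> F1 \<noteq> G1"
      using not_initial G0(1) G1(1) unfolding F0_def F1_def by blast
    then have "sum ?r G0 + (\<Sum>X\<in>G1. ?r (insert i X)) < sum ?r F0 + (\<Sum>X\<in>F1. ?r (insert i X))"
      using less0 less1 by (cases "F0 = G0"; cases "F1 = G1") auto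
    then show ?thesis
      unfolding F'_def Feq[symmetric] using fin finG notin by (simp add: sum_join_at)
  qed
  ultimately show ?thesis by blast
qed


section \<open>Compressed downsets\<close>

text \<open>Compression at every point leaves so little freedom that a family other than
  \<open>G\<close> must be \<open>G\<close> with its last set replaced by the next one.\<close>

lemma card_shadow_compressed:
  assumes S: "finite S" and F: "F \<subseteq> Pow S"
    and G: "level_colex_initial S G" "card G = card F"
    and compressed: "\<And>i. i \<in> S \<Longrightarrow> level_colex_initial (S - {i}) (deletion i F)"
      "\<And>i. i \<in> S \<Longrightarrow> level_colex_initial (S - {i}) (link i F)"
  shows "card (shadow G) \<le> card (shadow F)"
proof (cases "level_colex_initial S F")
  case True
  then have "G = F"
    using level_colex_initial_subset[OF S] G by (metis order_refl subset_antisym)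
  then show ?thesis by simp
next
  case False
  have fin: "finite Z" if "Z \<subseteq> S" for Z using that S by (rule finite_subset)
  \<comment> \<open>A member and a missing predecessor cannot agree at any \<open>i\<close>: they
    would violate initiality of the link if both contain \<open>i\<close>, and of the deletion if
    neither does.\<close>
  have compl: "Y = S - X" if XY: "X \<in> F" "Y \<subseteq> S" "Y \<notin> F" "level_colex_less Y X" for X Y
  proof -
    have XS: "X \<subseteq> S" using XY F by blast
    have "(i \<in> X) \<noteq> (i \<in> Y)" if i: "i \<in> S" for i
    proof
      assume eq: "(i \<in> X) = (i \<in> Y)"
      show False
      proof (cases "i \<in> X")
        case True
        then have ins: "insert i (X - {i}) = X" "insert i (Y - {i}) = Y" using eq by auto
        have "level_colex_less (Y - {i}) (X - {i})"
          using level_colex_less_insert_iff[of "Y - {i}" "X - {i}" i] ins fin[OF XS] fin[OF XY(2)]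
            XY(4) by simp
        moreover have "X - {i} \<in> link i F" using ins XY(1) by (simp add: link_def)
        ultimately have "Y - {i} \<in> link i F"
          using compressed(2)[OF i] XY(2) unfolding level_colex_initial_def by blast
        then show False using ins XY(3) by (simp add: link_def)
      next
        case False
        then have "X \<in> deletion i F" "Y \<subseteq> S - {i}" using eq XY by (auto simp: deletion_def)
        then have "Y \<in> deletion i F"
          using compressed(1)[OF i] XY(4) unfolding level_colex_initial_def by blast
        then show False using XY(3) by (simp add: deletion_def)
      qed
    qed
    then show ?thesis using XS XY(2) by blast
  qed
  obtain X Y where X: "X \<in> F" and Y: "Y \<subseteq> S" "Y \<notin> F" and YX: "level_colex_less Y X"
    using False F by (auto simp: level_colex_initial_def)
  have XS: "X \<subseteq> S" using X F by blast
  have Yc: "Y = S - X" using compl X Y YX by blast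
  define D where "D = {Z \<in> Pow S. level_colex_less Z Y}"
  \<comment> \<open>A set strictly between \<open>Y\<close> and \<open>X\<close> would be the
    complement of \<open>Y\<close> if it is in \<open>F\<close>, hence \<open>X\<close>, and the
    complement of \<open>X\<close> if it is not, hence \<open>Y\<close>.\<close>
  have between: "Z = Y \<or> level_colex_less Z Y" if Z: "Z \<subseteq> S" "level_colex_less Z X" for Z
  proof (rule ccontr)
    assume neg: "\<not> ?thesis"
    then have YZ: "level_colex_less Y Z"
      using level_colex_less_total[OF fin[OF Z(1)] fin[OF Y(1)]] by blast
    show False
    proof (cases "Z \<in> F")
      case True
      then have "Y = S - Z" using compl YZ Y by blast
      then have "Z = X" using Yc Z(1) XS by blast
      then show False using Z(2) level_colex_less_irrefl by blast
    next
      case False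
      then have "Z = S - X" using compl X Z by blast
      then show False using Yc neg by blast
    qed
  qed
  have F_eq: "F = insert X D"
  proof (intro equalityI subsetI)
    fix Z assume Z: "Z \<in> F"
    then have ZS: "Z \<subseteq> S" using F by blast
    have "Z \<noteq> Y" using Z Y by blast
    then consider "level_colex_less Z Y" | "level_colex_less Y Z"
      using level_colex_less_total[OF fin[OF ZS] fin[OF Y(1)]] by blast
    then show "Z \<in> insert X D"
    proof cases
      case 1
      then show ?thesis using ZS by (simp add: D_def)
    next
      case 2
      then have "Y = S - Z" using compl Z Y by blast
      then show ?thesis using Yc ZS XS by blast
    qed
  next
    fix Z assume "Z \<in> insert X D"
    then consider "Z = X" | "Z \<subseteq> S" "level_colex_less Z Y" by (auto simp: D_def)
    then show "Z \<in> F"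
    proof cases
      case 1
      then show ?thesis using X by simp
    next
      case 2
      have ZX: "level_colex_less Z X"
        using level_colex_less_trans[OF fin[OF 2(1)] fin[OF Y(1)] fin[OF XS] 2(2) YX] .
      show ?thesis
      proof (rule ccontr)
        assume "Z \<notin> F"
        then have "Z = Y" using compl X 2(1) ZX Yc by blast
        then show False using 2(2) level_colex_less_irrefl by blast
      qed
    qed
  qed
  have finD: "finite D" using S by (simp add: D_def)
  have "Y \<notin> D" "X \<notin> D"
    using level_colex_less_irrefl level_colex_less_trans[OF fin[OF Y(1)] fin[OF XS] fin[OF Y(1)] YX]
    by (auto simp: D_def)
  then have "card (insert Y D) = card G" using G(2) F_eq finD by simp
  moreover have "level_colex_initial S (insert Y D)"
    unfolding level_colex_initial_def D_def
    using Y(1) level_colex_less_trans[OF fin fin fin[OF Y(1)]] by blast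
  ultimately have G_eq: "G = insert Y D"
    using level_colex_initial_subset[OF S] G(1) by (metis order_refl subset_antisym)
  have shadow_insert: "shadow (insert Z D) = shadow D \<union> shadow {Z}" for Z
    by (auto simp: shadow_def)
  have "S \<noteq> {}" using Y(1) XS YX level_colex_less_irrefl by auto
  define s where "s = Min S"
  have s: "s \<in> S" "\<And>x. x \<in> S \<Longrightarrow> s \<le> x"
    using S \<open>S \<noteq> {}\<close> by (auto simp: s_def)
  \<comment> \<open>The families share \<open>D\<close>, so only \<open>shadow {Y}\<close> has to be
    found in \<open>shadow D\<close> or \<open>shadow {X}\<close>. The least point \<open>s\<close>
    of \<open>S\<close> decides which.\<close>
  have "shadow G \<subseteq> shadow F"
  proof (cases "s \<in> Y")
    case sY: False
    \<comment> \<open>Putting \<open>s\<close> in place of the deleted point \<open>j\<close> gives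
      a predecessor of \<open>Y\<close> with the same set \<open>U\<close> below it.\<close>
    have "shadow {Y} \<subseteq> shadow D"
    proof
      fix U assume "U \<in> shadow {Y}"
      then obtain j where j: "j \<notin> U" "insert j U = Y" by (auto simp: shadow_def)
      have "j \<in> S" using j(2) Y(1) by blast
      then have "s < j" using s(2)[of j] j sY by (cases "s = j") auto
      moreover have sU: "s \<notin> U" "U \<subseteq> S" using sY j Y(1) by auto
      ultimately have "insert s U \<in> D"
        using level_colex_less_exchange[OF fin[OF sU(2)] sU(1) j(1)] j(2) s(1) by (simp add: D_def)
      then show "U \<in> shadow D" using sU by (auto simp: shadow_def)
    qed
    then show ?thesis unfolding G_eq F_eq shadow_insert by blast
  next
    case sY: True
    \<comment> \<open>Here \<open>X\<close> and \<open>Y\<close> are singletons: replacing \<open>Min X\<close> by \<open>s\<close> gives a predecessor of \<open>X\<close>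
      of the same size, which can only be \<open>Y\<close>.\<close>
    have sX: "s \<notin> X" using sY Yc by blast
    have "X \<noteq> {}"
      using YX by (auto simp: level_colex_less_def)
    define x where "x = Min X"
    have x: "x \<in> X" using fin[OF XS] \<open>X \<noteq> {}\<close> by (simp add: x_def)
    define X' where "X' = insert s (X - {x})"
    have sx: "s < x" using s(2)[of x] x XS sX by (metis le_neq_implies_less subsetD)
    have X'X: "level_colex_less X' X"
      using level_colex_less_exchange[of "X - {x}" s x] sx sX x fin[OF XS]
      by (simp add: X'_def insert_absorb)
    have X'S: "X' \<subseteq> S" using XS s(1) by (auto simp: X'_def)
    have "card X > 0" using fin[OF XS] \<open>X \<noteq> {}\<close> by (simp add: card_gt_0_iff)
    then have cX': "card X' = card X"
      using sX x fin[OF XS] by (simp add: X'_def card_Diff_singleton)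
    \<comment> \<open>\<open>Y\<close> is squeezed between \<open>X'\<close> and \<open>X\<close>,
      which have equal size.\<close>
    have cards: "card Y = card X"
    proof -
      have "card X' \<le> card Y"
        using between[OF X'S X'X] by (auto simp: level_colex_less_def)
      moreover have "card Y \<le> card X" using YX by (auto simp: level_colex_less_def)
      ultimately show ?thesis using cX' by simp
    qed
    \<comment> \<open>With a second element, \<open>X\<close> would keep the largest point
      \<open>t\<close> of \<open>S\<close> after losing its minimum \<open>x\<close>. Then
      \<open>X'\<close> contains \<open>t\<close> and \<open>Y\<close> does not, so
      \<open>X'\<close> can neither equal nor precede \<open>Y\<close>.\<close>
    have "X - {x} = {}"
    proof (rule ccontr)
      assume ne: "X - {x} \<noteq> {}"
      define t where "t = Max S"
      have t: "t \<in> S" "\<And>y. y \<in> S \<Longrightarrow> y \<le> t" using S \<open>S \<noteq> {}\<close> by (auto simp: t_def)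
      obtain d where d: "d \<in> X" "d \<notin> Y" "\<forall>j>d. j \<in> Y \<longleftrightarrow> j \<in> X"
        using YX cards fin[OF Y(1)] fin[OF XS] by (auto simp: level_colex_less_iff)
      \<comment> \<open>Complementary sets differ at every point of \<open>S\<close>, so their
        largest difference is the largest point.\<close>
      have "d = t"
        using d t Yc XS by (metis DiffD2 DiffI le_neq_implies_less subsetD)
      then have tX: "t \<in> X" "t \<notin> Y" using d by auto
      obtain y where y: "y \<in> X" "y \<noteq> x" using ne by blast
      have "x < y" using y fin[OF XS] by (metis Min_le le_neq_implies_less x_def)
      then have "t \<noteq> x" using t(2)[of y] y XS by fastforce
      then have tX': "t \<in> X'" using tX by (simp add: X'_def)
      have "X' \<noteq> Y" using tX' tX by blast
      then have "level_colex_less X' Y" using between[OF X'S X'X] by blast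
      then obtain e where e: "e \<in> Y" "e \<notin> X'" "\<forall>j>e. j \<in> X' \<longleftrightarrow> j \<in> Y"
        using cards cX' fin[OF Y(1)] fin[OF X'S] by (auto simp: level_colex_less_iff)
      have "e \<le> t" using t(2) e(1) Y(1) by blast
      then show False using e tX' tX by (metis le_neq_implies_less)
    qed
    then have "X = {x}" using x by blast
    then have "card Y = 1" using cards by simp
    then obtain y where "Y = {y}" by (auto simp: card_1_singleton_iff)
    have single: "shadow {{z}} = {{}}" for z :: nat
      by (auto simp: shadow_def insert_eq_iff)
    show ?thesis
      unfolding G_eq F_eq shadow_insert unfolding \<open>X = {x}\<close> \<open>Y = {y}\<close> single by simp
  qed
  then show ?thesis using finite_shadow[OF S F] by (rule card_mono[rotated])
qed

text \<open>Among the downsets of the same size with no larger shadow, one of least rank sum cannot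
  be improved by \<open>compression\<close>, so it is compressed at every point. The empty ground
  set needs no separate base case.\<close>

theorem level_colex_initial_card_shadow_le:
  assumes "finite S" "F \<subseteq> Pow S" "down_closed F"
    and "level_colex_initial S G" "card G = card F"
  shows "card (shadow G) \<le> card (shadow F)"
  using assms
proof (induction S arbitrary: F G rule: finite_psubset_induct)
  case (psubset S)
  let ?P = "\<lambda>F'. F' \<subseteq> Pow S \<and> down_closed F' \<and> card F' = card F \<and>
    card (shadow F') \<le> card (shadow F)"
  have "?P F" using psubset.prems by simp
  then obtain F' where F': "?P F'"
    and min: "\<And>E. ?P E \<Longrightarrow> sum (level_colex_rank S) F' \<le> sum (level_colex_rank S) E"
    using ex_has_least_nat[of ?P F "sum (level_colex_rank S)"] by blast
  have "level_colex_initial (S - {i}) (deletion i F') \<and> level_colex_initial (S - {i}) (link i F')"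
    if i: "i \<in> S" for i
  proof (rule ccontr)
    assume neg: "\<not> ?thesis"
    have IH: "card (shadow G) \<le> card (shadow E)"
      if "E \<subseteq> Pow (S - {i})" "down_closed E" "level_colex_initial (S - {i}) G" "card G = card E"
      for E G
      using psubset.IH[of "S - {i}" E G] that i by blast
    obtain E where E: "E \<subseteq> Pow S" "down_closed E" "card E = card F'"
      "card (shadow E) \<le> card (shadow F')"
      "sum (level_colex_rank S) E < sum (level_colex_rank S) F'"
      using compression[OF psubset.hyps(1) i _ _ IH neg] F' by blast
    then show False using min[of E] F' by simp
  qed
  then have "card (shadow G) \<le> card (shadow F')"
    using card_shadow_compressed[OF psubset.hyps(1), of F' G] F' psubset.prems by simp
  then show ?case using F' by simp
qed


section \<open>Maximal elements\<close>

text \<open>In a downset, a proper superset of \<open>X\<close> within the family already yields a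
  one-point extension of \<open>X\<close> there.\<close>

lemma maximal_elements_down_closed:
  assumes "down_closed F"
  shows "maximal_elements F = F - shadow F"
proof (intro equalityI subsetI)
  fix X assume "X \<in> maximal_elements F"
  then show "X \<in> F - shadow F" by (auto simp: maximal_elements_def shadow_def)
next
  fix X assume X: "X \<in> F - shadow F"
  have "Y = X" if Y: "Y \<in> F" "X \<subseteq> Y" for Y
  proof (rule ccontr)
    assume "Y \<noteq> X"
    then obtain j where "j \<in> Y" "j \<notin> X" using Y by blast
    then have "insert j X \<in> F" using Y assms unfolding down_closed_def by blast
    then show False using X \<open>j \<notin> X\<close> by (auto simp: shadow_def)
  qed
  then show "X \<in> maximal_elements F" using X by (auto simp: maximal_elements_def)
qed

lemma num_maximal_down_closed:
  assumes "finite F" "down_closed F"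
  shows "num_maximal F = card F - card (shadow F)"
proof -
  have "shadow F \<subseteq> F" using assms(2) unfolding shadow_def down_closed_def by blast
  then show ?thesis
    using assms by (simp add: num_maximal_def maximal_elements_down_closed card_Diff_subset
        finite_subset)
qed

section \<open>Return to the lattice on \<open>{1..n}\<close>\<close>

lemma level_colex_first_initial: "level_colex_initial {1..n} (level_colex_first n k)"
  unfolding level_colex_initial_def
proof (intro conjI ballI impI)
  show "level_colex_first n k \<subseteq> Pow {1..n}"
    by (auto simp: level_colex_first_def boolean_lattice_def)
  fix X Y assume X: "X \<in> level_colex_first n k" and Y: "Y \<in> Pow {1..n}" "level_colex_less Y X"
  have B: "X \<in> boolean_lattice n" "Y \<in> boolean_lattice n"
    using X Y by (auto simp: level_colex_first_def boolean_lattice_def)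
  show "Y \<in> level_colex_first n k"
    using level_colex_rank_mono[OF B(2,1) Y(2)] X B by (simp add: level_colex_first_def)
qed

theorem theorem4:
  fixes n :: nat and A I :: "nat set set"
  assumes "downset n A"
    and "I = level_colex_first n (card A)"
  shows "num_maximal A \<le> num_maximal I"
proof -
  let ?S = "{1..n}"
  have A: "A \<subseteq> Pow ?S" "down_closed A"
    using assms(1) by (auto simp: downset_def down_closed_def boolean_lattice_def)
  have I: "level_colex_initial ?S I"
    using assms(2) level_colex_first_initial by simp
  have fin: "finite A" "finite I"
    using A(1) level_colex_initial_finite[OF _ I] by (auto intro: finite_subset)
  have "card A \<le> 2 ^ n"
    using card_mono[OF _ A(1)] by (simp add: card_Pow)
  then have card: "card I = card A"
    using assms(2) card_level_colex_first by simp
  have "card (shadow I) \<le> card (shadow A)"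
    using level_colex_initial_card_shadow_le[OF _ A I card] by simp
  \<comment> \<open>Both families have the same size, so the smaller shadow leaves at least as many
    maximal elements.\<close>
  then show ?thesis
    using num_maximal_down_closed[OF fin(1) A(2)] card
      num_maximal_down_closed[OF fin(2) level_colex_initial_down_closed[OF _ I]] by simp
qed

end
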